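(* Let $G=(V,E)$ be an undirected graph, let $L$ be a sequence of leaders derived by the SST algorithm from a group $\Gamma$ of (weight preserving) automorphisms of $G$, and let $S=S(L)$. Let $G^\star=(V^\star,E^\star)$ with $V^\star=V\cup\bar V$, where $\bar V=\{v_\ell:\ell\in L\}$ consists of one new node for each leader, and $E^\star=E\cup\{\{v_\ell,f\}: \ell\in L,\ f\in O_\ell\}$. Then $$P(G,S)=\{x\in\mathbb{R}^V : \exists\, y\in\mathbb{R}^{\bar V}\text{ with }(x,y)\in P(G^\star)\text{ and } x_\ell+y_{v_\ell}=1\text{ for all }\ell\in L\}.$$
   Context: All graphs are finite, simple and undirected. For a graph $H=(W,F)$, $P(H)=\mathrm{conv}\{x\in\{0,1\}^W: x_u+x_v\le 1 \text{ for all }\{u,v\}\in F\}$ is the stable set polytope. $\Gamma\le\mathcal{S}_V$ is a group of automorphisms of $G$ preserving the node weights. SST algorithm: initialize $\Gamma'\gets\Gamma$ and the empty sequence $L$. Repeat until $L$ contains all of $V$: (1) select (arbitrarily) $\ell\in V\setminus L$ and set $O_\ell\gets\{\gamma(\ell):\gamma\in\Gamma'\}$ (so $\ell\in O_\ell$); (2) append $\ell$ to $L$ and replace $\Gamma'$ by its subgroup of permutations fixing every element of $L$. $S(L)=\{(\ell,f):\ell\in L,\ f\in O_\ell\setminus\{\ell\}\}$ is the set of SST cuts, where $(\ell,f)$ represents $-x_\ell+x_f\le 0$, and $P(G,S)=\mathrm{conv}\{x\in P(G)\cap\{0,1\}^V : x_f\le x_\ell \text{ for all }(\ell,f)\in S\}$.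 *)

theory Defs
  imports "HOL-Analysis.Analysis" "HOL-Algebra.Bij"
begin

text \<open>A graph is given by its node set and its set of edges, an edge being a two-element set of
  nodes. Node sets are subsets of a finite type, so that a graph may also be empty.\<close>

definition simple_graph :: "'a set \<Rightarrow> 'a set set \<Rightarrow> bool" where
  "simple_graph V E \<longleftrightarrow> finite V \<and> (\<forall>e\<in>E. \<exists>u\<in>V. \<exists>v\<in>V. u \<noteq> v \<and> e = {u, v})"

text \<open>Permutations of \<open>V\<close> are represented as in \<^const>\<open>BijGroup\<close>: bijections of \<open>V\<close> that are
  \<^const>\<open>undefined\<close> outside \<open>V\<close>.\<close>

definition graph_automorphism :: "'a set \<Rightarrow> 'a set set \<Rightarrow> ('a \<Rightarrow> 'a) \<Rightarrow> bool" where
  "graph_automorphism V E \<gamma> \<longleftrightarrow>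
     \<gamma> \<in> Bij V \<and> (\<forall>u\<in>V. \<forall>v\<in>V. {\<gamma> u, \<gamma> v} \<in> E \<longleftrightarrow> {u, v} \<in> E)"

text \<open>The states \<open>(L, Orb, \<Gamma>')\<close> reachable by the SST algorithm; \<open>Orb l\<close> is the orbit recorded
  when the leader \<open>l\<close> was selected.\<close>

inductive sst_state ::
  "'a set \<Rightarrow> ('a \<Rightarrow> 'a) set \<Rightarrow> 'a list \<Rightarrow> ('a \<Rightarrow> 'a set) \<Rightarrow> ('a \<Rightarrow> 'a) set \<Rightarrow> bool"
  for V :: "'a set" and \<Gamma> :: "('a \<Rightarrow> 'a) set" where
  init: "sst_state V \<Gamma> [] (\<lambda>_. {}) \<Gamma>"
| select: "sst_state V \<Gamma> L Orb \<Gamma>' \<Longrightarrow> l \<in> V - set L \<Longrightarrow>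
     sst_state V \<Gamma> (L @ [l]) (Orb(l := {\<gamma> l | \<gamma>. \<gamma> \<in> \<Gamma>'}))
       {\<gamma> \<in> \<Gamma>'. \<forall>k \<in> set (L @ [l]). \<gamma> k = k}"

definition sst_output ::
  "'a set \<Rightarrow> ('a \<Rightarrow> 'a) set \<Rightarrow> 'a list \<Rightarrow> ('a \<Rightarrow> 'a set) \<Rightarrow> bool" where
  "sst_output V \<Gamma> L Orb \<longleftrightarrow> (\<exists>\<Gamma>'. sst_state V \<Gamma> L Orb \<Gamma>') \<and> V \<subseteq> set L"

text \<open>A pair \<open>(l, f)\<close> stands for the inequality \<open>- x\<^sub>l + x\<^sub>f \<le> 0\<close>.\<close>

definition sst_cuts :: "'a list \<Rightarrow> ('a \<Rightarrow> 'a set) \<Rightarrow> ('a \<times> 'a) set" where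
  "sst_cuts L Orb = {(l, f). l \<in> set L \<and> f \<in> Orb l - {l}}"

text \<open>The space \<open>\<real>\<^sup>W\<close> for a subset \<open>W\<close> of the index type is the coordinate subspace of the
  vectors vanishing outside \<open>W\<close>.\<close>

definition coord_space :: "'a::finite set \<Rightarrow> (real ^ 'a) set" where
  "coord_space W = {x. \<forall>u. u \<notin> W \<longrightarrow> x $ u = 0}"

definition binary_points :: "'a::finite set \<Rightarrow> (real ^ 'a) set" where
  "binary_points W = {x \<in> coord_space W. \<forall>u\<in>W. x $ u \<in> {0, 1}}"

definition stable_set_polytope :: "'a::finite set \<Rightarrow> 'a set set \<Rightarrow> (real ^ 'a) set" where
  "stable_set_polytope W F =
     convex hull {x \<in> binary_points W. \<forall>u v. {u, v} \<in> F \<longrightarrow> x $ u + x $ v \<le> 1}"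

definition sst_polytope ::
  "'a::finite set \<Rightarrow> 'a set set \<Rightarrow> ('a \<times> 'a) set \<Rightarrow> (real ^ 'a) set" where
  "sst_polytope V E S =
     convex hull {x \<in> stable_set_polytope V E \<inter> binary_points V. \<forall>(l, f) \<in> S. x $ f \<le> x $ l}"

text \<open>In the extended graph, \<open>Inl v\<close> is the original node \<open>v\<close> and \<open>Inr l\<close> is the new node
  \<open>v\<^sub>l\<close> of the leader \<open>l\<close>.\<close>

definition star_nodes :: "'a set \<Rightarrow> 'a list \<Rightarrow> ('a + 'a) set" where
  "star_nodes V L = Inl ` V \<union> Inr ` set L"

definition star_edges ::
  "'a set set \<Rightarrow> 'a list \<Rightarrow> ('a \<Rightarrow> 'a set) \<Rightarrow> ('a + 'a) set set" where
  "star_edges E L Orb = (\<lambda>e. Inl ` e) ` E \<union> {{Inr l, Inl f} | l f. l \<in> set L \<and> f \<in> Orb l}"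

text \<open>The vector \<open>(x, y)\<close>; a vector \<open>y\<close> over the new nodes is indexed by the leaders, so that
  \<open>y $ l\<close> is its entry at \<open>v\<^sub>l\<close>.\<close>

definition join_vec :: "real ^ 'a \<Rightarrow> real ^ 'a \<Rightarrow> real ^ ('a::finite + 'a)" where
  "join_vec x y = (\<chi> i. case i of Inl u \<Rightarrow> x $ u | Inr l \<Rightarrow> y $ l)"

end

theory Submission
  imports Defs
begin

text \<open>Let \<open>K\<close> be the set of \<open>0/1\<close> points of the stable set polytope of the extended graph.
  The identity permutation lies in every group occurring in the algorithm, so every leader \<open>l\<close>
  belongs to its own recorded orbit, \<open>{v\<^sub>l, l}\<close> is an edge of the extended graph, and
  \<open>x\<^sub>l + y\<^sub>l \<le> 1\<close> is valid for \<open>K\<close>. The equations \<open>x\<^sub>l + y\<^sub>l = 1\<close> therefore cut out a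
  face of \<open>convex hull K\<close>, and this face is the hull of the points of \<open>K\<close> that satisfy them
  (\<open>convex_hull_tight_valid_inequalities\<close>).

  A \<open>0/1\<close> point \<open>(x, y)\<close> with \<open>y\<^sub>l = 1 - x\<^sub>l\<close> for all leaders \<open>l\<close> is in \<open>K\<close> if and only if
  \<open>x\<close> is stable and satisfies the SST cuts, since the edge inequality \<open>y\<^sub>l + x\<^sub>f \<le> 1\<close> then reads
  \<open>x\<^sub>f \<le> x\<^sub>l\<close>. So the projection of the face to the old coordinates is the hull of the binary
  points that define the SST polytope (\<open>project_star_stable_point\<close>,
  \<open>extend_sst_stable_point\<close>).\<close>

lemma sst_state_leader_in_orbit:
  assumes "sst_state V \<Gamma> L Orb \<Gamma>'" and "(\<lambda>x\<in>V. x) \<in> \<Gamma>"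
  shows "set L \<subseteq> V \<and> (\<lambda>x\<in>V. x) \<in> \<Gamma>' \<and> (\<forall>l\<in>set L. l \<in> Orb l)"
  using assms
proof (induction rule: sst_state.induct)
  case init
  then show ?case by simp
next
  case (select L Orb \<Gamma>' l)
  have "l = (\<lambda>x\<in>V. x) l"
    using select.hyps(2) by simp
  then have "l \<in> {\<gamma> l | \<gamma>. \<gamma> \<in> \<Gamma>'}"
    using select.IH[OF select.prems] by blast
  then show ?case
    using select by auto
qed

lemma sst_output_leader_in_orbit:
  assumes "subgroup \<Gamma> (BijGroup V)" and "sst_output V \<Gamma> L Orb" and "l \<in> set L"
  shows "l \<in> Orb l"
proof -
  have "(\<lambda>x\<in>V. x) \<in> \<Gamma>"
    using subgroup.one_closed[OF assms(1)] by (simp add: BijGroup_def)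
  then show ?thesis
    using assms(2,3) sst_state_leader_in_orbit unfolding sst_output_def by blast
qed

lemma finite_binary_points: "finite (binary_points W)"
proof (rule finite_subset)
  show "binary_points W \<subseteq> vec_lambda ` (PiE UNIV (\<lambda>_. {0, 1}))"
  proof
    fix x :: "real ^ 'a"
    assume "x \<in> binary_points W"
    then have "vec_nth x \<in> PiE UNIV (\<lambda>_. {0, 1})"
      unfolding binary_points_def coord_space_def by (cases "\<forall>u. u \<in> W") auto
    then show "x \<in> vec_lambda ` (PiE UNIV (\<lambda>_. {0, 1}))"
      by (metis image_eqI vec_nth_inverse)
  qed
  show "finite (vec_lambda ` (PiE UNIV (\<lambda>_. {0, 1})))"
    by (intro finite_imageI finite_PiE) auto
qed

text \<open>Points of a hull at which finitely many valid inequalities \<open>a i \<bullet> z \<le> b i\<close> are all tight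
  are convex combinations of generators at which they are all tight. Summing the inequalities
  exhibits the set of these points as a face with a single supporting hyperplane.\<close>

lemma convex_hull_tight_valid_inequalities:
  fixes K :: "'b::euclidean_space set" and a :: "'i \<Rightarrow> 'b"
  assumes "compact K" and "finite I"
    and valid: "\<And>i z. i \<in> I \<Longrightarrow> z \<in> K \<Longrightarrow> a i \<bullet> z \<le> b i"
    and z: "z \<in> convex hull K" and tight: "\<And>i. i \<in> I \<Longrightarrow> a i \<bullet> z = b i"
  shows "z \<in> convex hull {z \<in> K. \<forall>i\<in>I. a i \<bullet> z = b i}"
proof -
  define T where "T = convex hull K \<inter> {z. sum a I \<bullet> z = sum b I}"
  have "K \<subseteq> {z. sum a I \<bullet> z \<le> sum b I}"
    using valid by (auto simp: inner_sum_left intro: sum_mono)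
  then have "convex hull K \<subseteq> {z. sum a I \<bullet> z \<le> sum b I}"
    by (intro hull_minimal convex_halfspace_le)
  then have "T face_of convex hull K"
    unfolding T_def by (intro face_of_Int_supporting_hyperplane_le convex_convex_hull) auto
  then obtain K' where K': "K' \<subseteq> K" "T = convex hull K'"
    using face_of_convex_hull_subset[OF \<open>compact K\<close>] by metis
  have "\<forall>i\<in>I. a i \<bullet> p = b i" if "p \<in> K'" for p
  proof -
    have "p \<in> T" using that K'(2) hull_inc by fast
    then have "(\<Sum>i\<in>I. b i - a i \<bullet> p) = 0"
      by (simp add: T_def inner_sum_left sum_subtractf)
    moreover have "0 \<le> b i - a i \<bullet> p" if "i \<in> I" for i
      using valid that \<open>p \<in> K'\<close> K'(1) by fastforce
    ultimately show ?thesis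
      using sum_nonneg_eq_0_iff[OF \<open>finite I\<close>, of "\<lambda>i. b i - a i \<bullet> p"] by auto
  qed
  then have "K' \<subseteq> {z \<in> K. \<forall>i\<in>I. a i \<bullet> z = b i}"
    using K'(1) by blast
  moreover have "z \<in> T"
    using z tight by (simp add: T_def inner_sum_left)
  ultimately show ?thesis
    using K'(2) hull_mono by blast
qed

lemma stable_set_polytope_edge_le:
  assumes "x \<in> stable_set_polytope W F" and "{u, v} \<in> F"
  shows "x $ u + x $ v \<le> 1"
proof -
  have "convex {x :: real ^ 'a. (axis u 1 + axis v 1) \<bullet> x \<le> 1}"
    by (rule convex_halfspace_le)
  then have "convex {x :: real ^ 'a. x $ u + x $ v \<le> 1}"
    by (simp add: inner_add_left inner_axis')
  then have "stable_set_polytope W F \<subseteq> {x. x $ u + x $ v \<le> 1}"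
    unfolding stable_set_polytope_def using assms(2) by (intro hull_minimal) auto
  then show ?thesis using assms(1) by auto
qed

lemma Inl_edge_in_star_edges:
  assumes "{u, v} \<in> E"
  shows "{Inl u, Inl v} \<in> star_edges E L Orb"
  unfolding star_edges_def by (rule UnI1, rule image_eqI[OF _ assms]) simp

lemma join_vec_Inl [simp]: "join_vec x y $ Inl u = x $ u"
  by (simp add: join_vec_def)

lemma join_vec_Inr [simp]: "join_vec x y $ Inr l = y $ l"
  by (simp add: join_vec_def)

lemma join_vec_convex_combination:
  "join_vec (s *\<^sub>R x + t *\<^sub>R x') (s *\<^sub>R y + t *\<^sub>R y') = s *\<^sub>R join_vec x y + t *\<^sub>R join_vec x' y'"
  by (simp add: vec_eq_iff join_vec_def split: sum.split)

lemma extend_sst_stable_point: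
  assumes x: "x \<in> stable_set_polytope V E" "x \<in> binary_points V"
    and cuts: "\<forall>(l, f) \<in> sst_cuts L Orb. x $ f \<le> x $ l"
  defines "y \<equiv> (\<chi> l. if l \<in> set L then 1 - x $ l else 0)"
  shows "join_vec x y \<in> stable_set_polytope (star_nodes V L) (star_edges E L Orb)"
proof -
  have "x $ u \<in> {0, 1}" for u
    using x(2) unfolding binary_points_def coord_space_def by (cases "u \<in> V") auto
  then have 01: "x $ u = 0 \<or> x $ u = 1" for u by simp
  have "join_vec x y \<in> coord_space (star_nodes V L)"
    unfolding coord_space_def
  proof (intro CollectI allI impI)
    fix i :: "'a + 'a"
    assume "i \<notin> star_nodes V L"
    then show "join_vec x y $ i = 0"
      using x(2) by (cases i) (auto simp: binary_points_def coord_space_def star_nodes_def y_def)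
  qed
  moreover have "join_vec x y $ i \<in> {0, 1}" for i
    using 01 by (cases i) (auto simp: y_def)
  ultimately have bin: "join_vec x y \<in> binary_points (star_nodes V L)"
    by (simp add: binary_points_def)
  have orbit: "x $ f + y $ l \<le> 1" if "l \<in> set L" "f \<in> Orb l" for l f
    using cuts that by (cases "f = l") (auto simp: sst_cuts_def y_def)
  have "join_vec x y $ i + join_vec x y $ j \<le> 1" if ij: "{i, j} \<in> star_edges E L Orb" for i j
  proof -
    consider (old) e where "e \<in> E" "{i, j} = Inl ` e"
      | (new) l f where "l \<in> set L" "f \<in> Orb l" "{i, j} = {Inr l, Inl f}"
      using ij unfolding star_edges_def by auto
    then show ?thesis
    proof cases
      case old
      have "i \<in> Inl ` e" "j \<in> Inl ` e" using old(2) by blast+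
      then obtain u v where uv: "i = Inl u" "j = Inl v" by blast
      then have "(Inl ` {u, v} :: ('a + 'a) set) = Inl ` e" using old(2) by simp
      then have "e = {u, v}" by (metis inj_image_eq_iff inj_Inl)
      then show ?thesis using stable_set_polytope_edge_le[OF x(1)] old(1) uv by simp
    next
      case new
      then show ?thesis using orbit[OF new(1,2)] by (auto simp: doubleton_eq_iff)
    qed
  qed
  then show ?thesis
    unfolding stable_set_polytope_def using bin by (intro hull_inc) auto
qed

lemma project_star_stable_point:
  assumes z: "z \<in> binary_points (star_nodes V L)"
    and edges: "\<forall>i j. {i, j} \<in> star_edges E L Orb \<longrightarrow> z $ i + z $ j \<le> 1"
    and tight: "\<forall>l\<in>set L. z $ Inl l + z $ Inr l = 1"
  shows "(\<chi> u. z $ Inl u) \<in> {x \<in> stable_set_polytope V E \<inter> binary_points V.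
    \<forall>(l, f) \<in> sst_cuts L Orb. x $ f \<le> x $ l}" (is "?x \<in> _")
proof -
  have bin: "?x \<in> binary_points V"
    using z by (auto simp: binary_points_def coord_space_def star_nodes_def)
  moreover have "?x \<in> stable_set_polytope V E"
    unfolding stable_set_polytope_def
    using bin edges Inl_edge_in_star_edges[of _ _ E L Orb] by (intro hull_inc) auto
  moreover have "z $ Inl f \<le> z $ Inl l" if "l \<in> set L" "f \<in> Orb l" for l f
  proof -
    have "{Inr l, Inl f} \<in> star_edges E L Orb"
      using that unfolding star_edges_def by blast
    then have "z $ Inr l + z $ Inl f \<le> 1"
      using edges by blast
    then show ?thesis using tight that(1) by force
  qed
  ultimately show ?thesis by (auto simp: sst_cuts_def)
qed

theorem proposition4p8:
  fixes V :: "'a::finite set" and E :: "'a set set" and w :: "'a \<Rightarrow> real"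
    and \<Gamma> :: "('a \<Rightarrow> 'a) set" and L :: "'a list" and Orb :: "'a \<Rightarrow> 'a set"
  assumes "simple_graph V E"
    and "subgroup \<Gamma> (BijGroup V)"
    and "\<And>\<gamma>. \<gamma> \<in> \<Gamma> \<Longrightarrow> graph_automorphism V E \<gamma>"
    and "\<And>\<gamma> v. \<gamma> \<in> \<Gamma> \<Longrightarrow> v \<in> V \<Longrightarrow> w (\<gamma> v) = w v"
    and "sst_output V \<Gamma> L Orb"
  shows "sst_polytope V E (sst_cuts L Orb) =
    {x \<in> coord_space V. \<exists>y \<in> coord_space (set L).
        join_vec x y \<in> stable_set_polytope (star_nodes V L) (star_edges E L Orb) \<and>
        (\<forall>l \<in> set L. x $ l + y $ l = 1)}"
    (is "_ = ?R")
proof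
  let ?P = "stable_set_polytope (star_nodes V L) (star_edges E L Orb)"
  let ?I = "{x \<in> stable_set_polytope V E \<inter> binary_points V.
    \<forall>(l, f) \<in> sst_cuts L Orb. x $ f \<le> x $ l}"
  have "convex ?R"
  proof (rule convexI)
    fix x x' and s t :: real
    assume x: "x \<in> ?R" and x': "x' \<in> ?R" and st: "0 \<le> s" "0 \<le> t" "s + t = 1"
    obtain y where y: "y \<in> coord_space (set L)" "join_vec x y \<in> ?P"
        "\<forall>l \<in> set L. x $ l + y $ l = 1"
      using x by blast
    obtain y' where y': "y' \<in> coord_space (set L)" "join_vec x' y' \<in> ?P"
        "\<forall>l \<in> set L. x' $ l + y' $ l = 1"
      using x' by blast
    let ?x = "s *\<^sub>R x + t *\<^sub>R x'" and ?y = "s *\<^sub>R y + t *\<^sub>R y'"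
    have "convex ?P"
      by (simp add: stable_set_polytope_def)
    then have "join_vec ?x ?y \<in> ?P"
      using y(2) y'(2) st by (simp add: join_vec_convex_combination convexD)
    moreover have "?x $ l + ?y $ l = 1" if "l \<in> set L" for l
    proof -
      have "?x $ l + ?y $ l = s * (x $ l + y $ l) + t * (x' $ l + y' $ l)"
        by (simp add: algebra_simps)
      then show ?thesis using y(3) y'(3) st(3) that by simp
    qed
    moreover have "?x \<in> coord_space V" "?y \<in> coord_space (set L)"
      using x x' y(1) y'(1) by (auto simp: coord_space_def)
    ultimately show "?x \<in> ?R" by blast
  qed
  moreover have "?I \<subseteq> ?R"
  proof
    fix x
    assume x: "x \<in> ?I"
    let ?y = "\<chi> l. if l \<in> set L then 1 - x $ l else 0"
    have "join_vec x ?y \<in> ?P"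
      using extend_sst_stable_point[of x] x by blast
    moreover have "x \<in> coord_space V" "?y \<in> coord_space (set L)"
      using x by (auto simp: binary_points_def coord_space_def)
    ultimately show "x \<in> ?R" by force
  qed
  ultimately show "sst_polytope V E (sst_cuts L Orb) \<subseteq> ?R"
    unfolding sst_polytope_def by (intro hull_minimal)

  show "?R \<subseteq> sst_polytope V E (sst_cuts L Orb)"
  proof
    fix x
    assume "x \<in> ?R"
    then obtain y where P: "join_vec x y \<in> ?P" and xy: "\<forall>l \<in> set L. x $ l + y $ l = 1"
      by blast
    define K where "K = {z \<in> binary_points (star_nodes V L).
      \<forall>i j. {i, j} \<in> star_edges E L Orb \<longrightarrow> z $ i + z $ j \<le> 1}"
    define a :: "'a \<Rightarrow> real ^ ('a + 'a)" where "a l = axis (Inl l) 1 + axis (Inr l) 1" for l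
    have a: "a l \<bullet> z = z $ Inl l + z $ Inr l" for l z
      by (simp add: a_def inner_add_left inner_axis')
    define K1 where "K1 = {z \<in> K. \<forall>l\<in>set L. a l \<bullet> z = 1}"
    have "join_vec x y \<in> convex hull K1"
      unfolding K1_def
    proof (rule convex_hull_tight_valid_inequalities)
      have "K \<subseteq> binary_points (star_nodes V L)"
        unfolding K_def by blast
      then show "compact K"
        using finite_binary_points finite_subset finite_imp_compact by blast
      show "join_vec x y \<in> convex hull K"
        using P unfolding stable_set_polytope_def K_def .
      show "a l \<bullet> z \<le> 1" if "l \<in> set L" "z \<in> K" for l z
      proof -
        \<comment> \<open>The leader belongs to its own orbit, so it is adjacent to its new node.\<close>
        have "l \<in> Orb l"
          using sst_output_leader_in_orbit assms(2,5) that(1) .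
        then have "{Inl l, Inr l} \<in> star_edges E L Orb"
          using that(1) unfolding star_edges_def by blast
        then show ?thesis
          using that(2) unfolding a K_def by blast
      qed
    qed (use xy in \<open>simp_all add: a\<close>)
    moreover define \<pi> :: "real ^ ('a + 'a) \<Rightarrow> real ^ 'a" where "\<pi> z = (\<chi> u. z $ Inl u)" for z
    moreover have "linear \<pi>"
      by (rule linearI) (simp_all add: \<pi>_def vec_eq_iff)
    ultimately have "\<pi> (join_vec x y) \<in> convex hull (\<pi> ` K1)"
      by (metis convex_hull_linear_image imageI)
    then have "x \<in> convex hull (\<pi> ` K1)"
      by (simp add: \<pi>_def)
    moreover have "\<pi> ` K1 \<subseteq> ?I"
    proof (rule image_subsetI)
      fix z
      assume "z \<in> K1"
      then show "\<pi> z \<in> ?I"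
        unfolding \<pi>_def by (intro project_star_stable_point) (simp_all add: K1_def K_def a)
    qed
    ultimately show "x \<in> sst_polytope V E (sst_cuts L Orb)"
      unfolding sst_polytope_def by (rule subsetD[OF hull_mono, rotated])
  qed
qed

end
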